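(* The following statements are true: (a) Every bilaterally $\mathbb{Q}$-continuous function $f:\mathbb{R}\to\mathbb{R}$ is $\mathbb{Q}$-continuous. (b) Every $\mathbb{Q}$-continuous function $f:\mathbb{R}\to\mathbb{R}$ is $\tau_{\mathbb{Q}}$-continuous.
   Context: For real $y\neq z$ put $S(y,z)=\{qy+(1-q)z: q\in\mathbb{Q}\cap[0,1]\}$. $f:\mathbb{R}\to\mathbb{R}$ is $\mathbb{Q}$-continuous at $x$ from the left if there is $\epsilon>0$ such that for all $y,z$ with $x-\epsilon<y<z\le x$ there is a continuous (in the usual sense) function $f_{y,z}:[y,z]\to\mathbb{R}$ with $f_{y,z}(t)=f(t)$ for all $t\in S(y,z)$; from the right: analogously with $x\le y<z<x+\epsilon$. $f$ is $\mathbb{Q}$-continuous if at every $x\in\mathbb{R}$ it is $\mathbb{Q}$-continuous from both sides. $f$ is bilaterally $\mathbb{Q}$-continuous if for every $x\in\mathbb{R}$ there is $\epsilon>0$ such that for all $y,z$ with $x-\epsilon\le y<z\le x+\epsilon$ such a continuous $f_{y,z}$ exists. The topology $\tau_{\mathbb{Q}}$ on $\mathbb{R}$: a set $U\subseteq\mathbb{R}$ is $\tau_{\mathbb{Q}}$-open iff for every $a\in U$ and every real $x\neq0$ there is $\varepsilon(a,x)>0$ such that $a+qx\in U$ for all $q\in\mathbb{Q}$ with $0<q<\varepsilon(a,x)$. A function is $\tau_{\mathbb{Q}}$-continuous if it is continuous from $(\mathbb{R},\tau_{\mathbb{Q}})$ to $\mathbb{R}$ with the usual topology. *)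

theory Defs
  imports "HOL-Analysis.Analysis"
begin

definition S :: "real \<Rightarrow> real \<Rightarrow> real set" where
  "S y z = {q * y + (1 - q) * z | q. q \<in> \<rat> \<inter> {0..1}}"

(* The function f_{y,z} lives on [y,z]; it is rendered as a total function g of which only
   the restriction to {y..z} matters. *)
definition has_cont_interp :: "(real \<Rightarrow> real) \<Rightarrow> real \<Rightarrow> real \<Rightarrow> bool" where
  "has_cont_interp f y z \<longleftrightarrow>
     (\<exists>g :: real \<Rightarrow> real. continuous_on {y..z} g \<and> (\<forall>t\<in>S y z. g t = f t))"

definition Q_continuous_left_at :: "(real \<Rightarrow> real) \<Rightarrow> real \<Rightarrow> bool" where
  "Q_continuous_left_at f x \<longleftrightarrow>
     (\<exists>\<epsilon>>0. \<forall>y z. x - \<epsilon> < y \<and> y < z \<and> z \<le> x \<longrightarrow> has_cont_interp f y z)"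

definition Q_continuous_right_at :: "(real \<Rightarrow> real) \<Rightarrow> real \<Rightarrow> bool" where
  "Q_continuous_right_at f x \<longleftrightarrow>
     (\<exists>\<epsilon>>0. \<forall>y z. x \<le> y \<and> y < z \<and> z < x + \<epsilon> \<longrightarrow> has_cont_interp f y z)"

definition Q_continuous :: "(real \<Rightarrow> real) \<Rightarrow> bool" where
  "Q_continuous f \<longleftrightarrow> (\<forall>x. Q_continuous_left_at f x \<and> Q_continuous_right_at f x)"

definition bilaterally_Q_continuous :: "(real \<Rightarrow> real) \<Rightarrow> bool" where
  "bilaterally_Q_continuous f \<longleftrightarrow>
     (\<forall>x. \<exists>\<epsilon>>0. \<forall>y z. x - \<epsilon> \<le> y \<and> y < z \<and> z \<le> x + \<epsilon> \<longrightarrow> has_cont_interp f y z)"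

definition tau_Q_open :: "real set \<Rightarrow> bool" where
  "tau_Q_open U \<longleftrightarrow>
     (\<forall>a\<in>U. \<forall>x. x \<noteq> 0 \<longrightarrow> (\<exists>\<epsilon>>0. \<forall>q\<in>\<rat>. 0 < q \<and> q < \<epsilon> \<longrightarrow> a + q * x \<in> U))"

definition tau_Q :: "real topology" where
  "tau_Q = topology tau_Q_open"

lemma istopology_tau_Q_open: "istopology tau_Q_open"
  unfolding istopology_def
proof (intro conjI allI impI)
  fix U V assume U: "tau_Q_open U" and V: "tau_Q_open V"
  show "tau_Q_open (U \<inter> V)"
    unfolding tau_Q_open_def
  proof (intro ballI allI impI)
    fix a x :: real assume a: "a \<in> U \<inter> V" and x: "x \<noteq> 0"
    obtain d where d: "d > 0" "\<forall>q\<in>\<rat>. 0 < q \<and> q < d \<longrightarrow> a + q * x \<in> U"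
      using U a x unfolding tau_Q_open_def by blast
    obtain e where e: "e > 0" "\<forall>q\<in>\<rat>. 0 < q \<and> q < e \<longrightarrow> a + q * x \<in> V"
      using V a x unfolding tau_Q_open_def by blast
    show "\<exists>\<epsilon>>0. \<forall>q\<in>\<rat>. 0 < q \<and> q < \<epsilon> \<longrightarrow> a + q * x \<in> U \<inter> V"
      using d e by (intro exI[of _ "min d e"]) auto
  qed
next
  fix K assume "\<forall>U\<in>K. tau_Q_open U"
  then show "tau_Q_open (\<Union>K)"
    unfolding tau_Q_open_def by (meson UnionE UnionI)
qed

lemma openin_tau_Q: "openin tau_Q U \<longleftrightarrow> tau_Q_open U"
  by (simp add: tau_Q_def topology_inverse' istopology_tau_Q_open)

lemma topspace_tau_Q [simp]: "topspace tau_Q = UNIV"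
proof -
  have "openin tau_Q UNIV"
    unfolding openin_tau_Q tau_Q_open_def by (auto intro: exI[of _ 1])
  then show ?thesis
    using openin_subset by blast
qed

definition tau_Q_continuous :: "(real \<Rightarrow> real) \<Rightarrow> bool" where
  "tau_Q_continuous f \<longleftrightarrow> continuous_map tau_Q euclideanreal f"

end

theory Submission
  imports Defs
begin

text \<open>
  Part (a) is a matter of shrinking intervals: the two-sided condition at \<open>x\<close> quantifies over a
  larger family of pairs \<open>y < z\<close> than either one-sided condition.

  For part (b), fix an open \<open>V\<close> with \<open>f a \<in> V\<close> and a direction \<open>x \<noteq> 0\<close>. The one-sided condition
  at \<open>a\<close>, on the side to which \<open>x\<close> points, is applied to the segment joining \<open>a\<close> to \<open>a + r * x\<close>.
  The point is to take the scale \<open>r\<close> \<^emph>\<open>rational\<close>: then the rational convex combinations of the two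
  endpoints are exactly the points \<open>a + q * x\<close> with \<open>q\<close> rational in \<open>[0, r]\<close>, so on all of these
  \<open>f\<close> agrees with one and the same continuous function, whose continuity at \<open>a\<close> keeps the values
  \<open>f (a + q * x)\<close> in \<open>V\<close> for small \<open>q\<close>.
\<close>

lemma bilaterally_Q_continuous_imp_Q_continuous:
  assumes "bilaterally_Q_continuous f"
  shows "Q_continuous f"
  unfolding Q_continuous_def
proof
  fix x
  obtain e where "e > 0"
    and e: "\<And>y z. x - e \<le> y \<and> y < z \<and> z \<le> x + e \<Longrightarrow> has_cont_interp f y z"
    using assms unfolding bilaterally_Q_continuous_def by blast
  have "Q_continuous_left_at f x"
    unfolding Q_continuous_left_at_def using \<open>e > 0\<close> by (intro exI[of _ e]) (auto intro: e)
  moreover have "Q_continuous_right_at f x"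
    unfolding Q_continuous_right_at_def using \<open>e > 0\<close> by (intro exI[of _ e]) (auto intro: e)
  ultimately show "Q_continuous_left_at f x \<and> Q_continuous_right_at f x" ..
qed

lemma S_commute: "S y z = S z y"
proof -
  have "S u v \<subseteq> S v u" for u v
  proof
    fix t assume "t \<in> S u v"
    then obtain q where "q \<in> \<rat>" "0 \<le> q" "q \<le> 1" "t = q * u + (1 - q) * v"
      unfolding S_def by auto
    then show "t \<in> S v u"
      unfolding S_def by (intro CollectI exI[of _ "1 - q"]) auto
  qed
  then show ?thesis by blast
qed

text \<open>Dividing \<open>q\<close> by \<open>r\<close> gives a convex coefficient that is again rational; this is where the
  rationality of the scale \<open>r\<close> enters.\<close>

lemma rational_multiple_in_S:
  assumes "r \<in> \<rat>" "r > 0" "q \<in> \<rat>" "0 \<le> q" "q \<le> r"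
  shows "a + q * x \<in> S (a + r * x) a"
  unfolding S_def using assms
  by (intro CollectI exI[of _ "q / r"]) (auto simp: field_simps)

text \<open>Both sides of \<open>a\<close> are treated at once: the unoriented interval between \<open>a\<close> and \<open>a + r * x\<close>
  is parametrised by \<open>[0, r]\<close>, starting at \<open>a\<close>, whatever the sign of \<open>x\<close>.\<close>

lemma has_cont_interp_imp_ray_in_open:
  assumes interp: "has_cont_interp f (min a (a + r * x)) (max a (a + r * x))"
    and r: "r \<in> \<rat>" "r > 0"
    and V: "open V" "f a \<in> V"
  shows "\<exists>\<epsilon>>0. \<forall>q\<in>\<rat>. 0 < q \<and> q < \<epsilon> \<longrightarrow> f (a + q * x) \<in> V"
proof -
  let ?I = "{min a (a + r * x)..max a (a + r * x)}"
  obtain g where g: "continuous_on ?I g"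
    and "\<forall>t\<in>S (min a (a + r * x)) (max a (a + r * x)). g t = f t"
    using interp unfolding has_cont_interp_def by blast
  then have "\<forall>t\<in>S (a + r * x) a. g t = f t"
    by (auto simp: min_def max_def S_commute[of "a + r * x"] split: if_splits)
  then have gf: "g (a + q * x) = f (a + q * x)" if "q \<in> \<rat>" "0 \<le> q" "q \<le> r" for q
    using rational_multiple_in_S[OF r that] by blast
  have "(\<lambda>q. a + q * x) ` {0..r} \<subseteq> ?I"
  proof
    fix t assume "t \<in> (\<lambda>q. a + q * x) ` {0..r}"
    then obtain q where q: "0 \<le> q" "q \<le> r" "t = a + q * x" by auto
    show "t \<in> ?I"
    proof (cases "x \<ge> 0")
      case True
      then have "0 \<le> q * x" "q * x \<le> r * x" using q by (auto intro: mult_right_mono)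
      then show ?thesis using q by auto
    next
      case False
      then have "q * x \<le> 0" "r * x \<le> q * x"
        using q by (auto intro: mult_right_mono_neg simp: mult_nonneg_nonpos)
      then show ?thesis using q by auto
    qed
  qed
  then have "continuous_on {0..r} (\<lambda>q. g (a + q * x))"
    by (intro continuous_on_compose2[OF g]) (auto intro!: continuous_intros)
  then have "((\<lambda>q. g (a + q * x)) \<longlongrightarrow> g (a + 0 * x)) (at 0 within {0..r})"
    using r unfolding continuous_on_def by (meson atLeastAtMost_iff less_imp_le order_refl)
  moreover have "g (a + 0 * x) \<in> V"
    using gf[of 0] r V by simp
  ultimately have "\<forall>\<^sub>F q in at 0 within {0..r}. g (a + q * x) \<in> V"
    using V topological_tendstoD by blast
  then obtain d where "d > 0"
    and d: "\<And>q. q \<in> {0..r} \<Longrightarrow> q \<noteq> 0 \<Longrightarrow> dist q 0 < d \<Longrightarrow> g (a + q * x) \<in> V"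
    unfolding eventually_at by blast
  have "f (a + q * x) \<in> V" if "q \<in> \<rat>" "0 < q" "q < min r d" for q
    using d[of q] gf[of q] that by simp
  then show ?thesis
    using \<open>d > 0\<close> r by (intro exI[of _ "min r d"]) auto
qed

lemma Q_continuous_imp_tau_Q_continuous:
  assumes f: "Q_continuous f"
  shows "tau_Q_continuous f"
proof -
  have "tau_Q_open {t. f t \<in> V}" if V: "open V" for V
    unfolding tau_Q_open_def
  proof (intro ballI allI impI)
    fix a x :: real assume "a \<in> {t. f t \<in> V}" and x: "x \<noteq> 0"
    then have a: "f a \<in> V" by simp
    obtain e1 where "e1 > 0"
      and left: "\<And>y z. a - e1 < y \<Longrightarrow> y < z \<Longrightarrow> z \<le> a \<Longrightarrow> has_cont_interp f y z"
      using f unfolding Q_continuous_def Q_continuous_left_at_def by metis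
    obtain e2 where "e2 > 0"
      and right: "\<And>y z. a \<le> y \<Longrightarrow> y < z \<Longrightarrow> z < a + e2 \<Longrightarrow> has_cont_interp f y z"
      using f unfolding Q_continuous_def Q_continuous_right_at_def by metis
    have "0 < min e1 e2 / \<bar>x\<bar>" using x \<open>e1 > 0\<close> \<open>e2 > 0\<close> by simp
    then obtain r where r: "r \<in> \<rat>" "0 < r" "r < min e1 e2 / \<bar>x\<bar>"
      using Rats_dense_in_real by blast
    then have small: "r * \<bar>x\<bar> < min e1 e2" using x by (simp add: pos_less_divide_eq)
    have "has_cont_interp f (min a (a + r * x)) (max a (a + r * x))"
    proof (cases "x > 0")
      case True
      then have "0 < r * x" using r by simp
      then show ?thesis using right[of a "a + r * x"] small True by simp
    next
      case False
      then have "r * x < 0" using r x by (simp add: mult_pos_neg)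
      then show ?thesis using left[of "a + r * x" a] small False by simp
    qed
    then show "\<exists>\<epsilon>>0. \<forall>q\<in>\<rat>. 0 < q \<and> q < \<epsilon> \<longrightarrow> a + q * x \<in> {t. f t \<in> V}"
      using has_cont_interp_imp_ray_in_open r V a by simp
  qed
  then show ?thesis
    unfolding tau_Q_continuous_def continuous_map_def by (simp add: openin_tau_Q)
qed

theorem theorem4p4:
  shows "(\<forall>f :: real \<Rightarrow> real. bilaterally_Q_continuous f \<longrightarrow> Q_continuous f) \<and>
         (\<forall>f :: real \<Rightarrow> real. Q_continuous f \<longrightarrow> tau_Q_continuous f)"
  using bilaterally_Q_continuous_imp_Q_continuous Q_continuous_imp_tau_Q_continuous by blast

end
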